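(* Let $\mathrm{Domb}(n)=\sum_{k=0}^{n}\binom{n}{k}^2\binom{2k}{k}\binom{2(n-k)}{n-k}$, and let $p$ be a prime with $p\equiv1\pmod 3$. Then \[\sum_{n=2}^{p-1}\frac{(n+1)^2}{n(n-1)}\cdot\frac{\mathrm{Domb}(n)}{16^n}\equiv\frac{3}{2}\pmod{p^2}.\]
   Context: A congruence between rational numbers whose denominators are coprime to $p$ is understood in the ring of rationals with denominators prime to $p$ ($p$-adic integers): $x\equiv y\pmod{p^2}$ means $(x-y)/p^2$ has denominator coprime to $p$. *)

theory Defs
  imports "HOL-Number_Theory.Number_Theory"
begin

definition Domb :: "nat \<Rightarrow> nat" where
  "Domb n = (\<Sum>k=0..n. (n choose k)^2 * ((2*k) choose k) * ((2*(n-k)) choose (n-k)))"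

definition rat_cong_mod :: "nat \<Rightarrow> rat \<Rightarrow> rat \<Rightarrow> int \<Rightarrow> bool" where
  "rat_cong_mod p x y m \<longleftrightarrow>
     (\<exists>a b::int. b \<noteq> 0 \<and> coprime b (int p) \<and> x - y = of_int m * (of_int a / of_int b))"

end

theory Submission
  imports Defs
begin

text \<open>
  Put \<open>s n = Domb n / 16 ^ n\<close>. Creative telescoping gives a second-order recurrence for \<open>s\<close>.
  Applying the adjoint of that recurrence to \<open>1 / (2 * (n + 1))\<close> shows that the sum in question
  equals \<open>3/2 + (\<Sum>n<p. (3 * n + 1) * s n) / 2\<close> up to boundary terms divisible by \<open>p\<^sup>2\<close>.

  The same recurrence is satisfied by \<open>\<Sum>k\<le>n. (-1/16)^k (2k)! / k!^5 * (n + 2k)! / (n - k)!\<close>, so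
  \<open>s n\<close> has this second expression, in which multiplication by \<open>3n + 1\<close> and summation over
  \<open>n < p\<close> can be carried out in closed form for each \<open>k\<close>. Modulo \<open>p\<^sup>2\<close> the terms with \<open>k > h = (p - 1)/2\<close>
  vanish and the remaining ones sum to a unit multiple of \<open>p * (\<Sum>k\<le>h. (2k choose k)\<^sup>2 / (16^k (3k + 2)))\<close>.
  With \<open>a = (p + 2)/3 \<le> h\<close>, the inner sum is congruent modulo \<open>p\<close> to a third of
  \<open>\<Sum>k\<le>h. (-1)^k (h choose k) (h + k choose k) / (k + a)\<close>. The latter is an \<open>h\<close>-th finite difference of
  a polynomial in \<open>k\<close> of degree \<open>h - 1\<close>, because \<open>k + a\<close> divides \<open>(k + 1) \<dots> (k + h)\<close>; hence it is zero.
\<close>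

section \<open>Domb numbers\<close>

text \<open>This is the central binomial coefficient of \<open>2 * k\<close> divided by
  \<open>k!^2\<close>. With this weight \<open>Domb n / n!^2\<close> becomes a convolution square,
  so each step in \<open>n\<close> or \<open>k\<close> is a rational factor.\<close>

definition domb_weight :: "nat \<Rightarrow> rat" where
  "domb_weight k = fact (2 * k) / fact k ^ 4"

lemma domb_weight_0 [simp]: "domb_weight 0 = 1"
  by (simp add: domb_weight_def)

lemma domb_weight_Suc: "of_nat (k + 1) ^ 3 * domb_weight (Suc k) = 2 * (2 * of_nat k + 1) * domb_weight k"
proof -
  have "(fact (2 * Suc k) :: rat) = (2 * of_nat k + 2) * (2 * of_nat k + 1) * fact (2 * k)"
    by (simp add: algebra_simps)
  moreover have "(fact (Suc k) :: rat) = (of_nat k + 1) * fact k"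
    by simp
  moreover have "(of_nat k + 1 :: rat) \<noteq> 0"
    by (metis of_nat_Suc of_nat_eq_0_iff nat.distinct(1) add.commute)
  ultimately show ?thesis
    unfolding domb_weight_def
    by (simp add: divide_simps del: fact_Suc) (simp add: algebra_simps power_numeral_reduce)
qed

lemma Domb_conv_weight:
  "of_nat (Domb n) = (fact n)\<^sup>2 * (\<Sum>k\<le>n. domb_weight k * domb_weight (n - k))"
proof -
  have "(of_nat ((n choose k)\<^sup>2 * ((2*k) choose k) * ((2*(n-k)) choose (n-k))) :: rat)
        = (fact n)\<^sup>2 * (domb_weight k * domb_weight (n - k))" if "k \<le> n" for k
  proof -
    have "(of_nat (n choose k) :: rat) = fact n / (fact k * fact (n - k))"
      using that by (rule binomial_fact)
    moreover have central: "(of_nat ((2 * j) choose j) :: rat) = fact (2 * j) / (fact j * fact j)" for j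
      by (subst binomial_fact) (auto simp: mult_2)
    ultimately show ?thesis
      unfolding domb_weight_def of_nat_mult of_nat_power
      by (simp only: central) (simp add: field_simps power_numeral_reduce)
  qed
  then show ?thesis
    unfolding Domb_def of_nat_sum sum_distrib_left atMost_atLeast0
    by (intro sum.cong refl) (metis atLeastAtMost_iff)
qed

text \<open>
  The right-hand sides of \<open>domb_weight_telescope\<close> and \<open>domb_binomial_telescope\<close> are Zeilberger
  certificates, written so that they remain meaningful at \<open>K = n + 1\<close>.
\<close>

lemma domb_weight_telescope:
  fixes n K :: nat
  defines "N \<equiv> of_nat n :: rat"
  assumes "K \<le> n + 1"
  shows "(\<Sum>k<K. (N+2)^5 * (domb_weight k * domb_weight (n+2-k))
            - 2 * ((2*N+3) * (5*N^2+15*N+12)) * (domb_weight k * domb_weight (n+1-k))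
            + 64 * (N+1) * (domb_weight k * domb_weight (n-k)))
     = of_nat K ^ 3 * (16 * of_nat K ^ 3 - (72*N+120) * of_nat K ^ 2 + (104*N^2+356*N+296) * of_nat K
          - (48*N^3+248*N^2+416*N+224)) * domb_weight K * domb_weight (n+2-K) / (4 * (2*N+3-2*of_nat K))"
  using assms(2)
proof (induction K)
  case 0
  then show ?case by simp
next
  case (Suc K)
  \<comment> \<open>Writing \<open>n = K + m\<close> removes all truncated subtraction. Every weight
    is then a rational multiple of \<open>domb_weight K\<close> or of \<open>y\<close>, and the
    claim becomes an identity of rational functions in \<open>x\<close> and
    \<open>M\<close>.\<close>
  then obtain m where n: "n = K + m"
    using le_Suc_ex by auto
  define M x y where "M = (of_nat m :: rat)" and "x = (of_nat K :: rat)" and "y = domb_weight (Suc (Suc m))"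
  have nz: "2*M+1 \<noteq> 0" "2*M+3 \<noteq> 0" "x + 1 \<noteq> 0"
    unfolding M_def x_def by (simp_all add: add_nonneg_eq_0_iff)
  have u1: "domb_weight (Suc m) = (M+2)^3 * y / (2*(2*M+3))"
    using domb_weight_Suc[of "Suc m"] nz unfolding y_def M_def by (simp add: field_simps)
  have u0: "domb_weight m = (M+1)^3 * domb_weight (Suc m) / (2*(2*M+1))"
    using domb_weight_Suc[of m] nz unfolding M_def by (simp add: field_simps)
  have uK: "domb_weight (Suc K) = 2*(2*x+1) * domb_weight K / (x+1)^3"
    using domb_weight_Suc[of K] nz unfolding x_def by (simp add: field_simps)
  have N: "N = x + M"
    by (simp add: N_def n x_def M_def)
  have sub: "n+2-K = Suc (Suc m)" "n+1-K = Suc m" "n-K = m" "n+2-Suc K = Suc m" "of_nat (Suc K) = x + 1"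
    by (auto simp: n x_def)
  have den: "2*N+3-2*x = 2*M+3" "2*N+3-2*(x+1) = 2*M+1"
    by (simp_all add: N)
  have "x^3 * (16 * x^3 - (72*N+120) * x^2 + (104*N^2+356*N+296) * x
          - (48*N^3+248*N^2+416*N+224)) * v * y / (4 * (2*M+3))
        + ((N+2)^5 * (v * y)
            - 2 * ((2*N+3) * (5*N^2+15*N+12)) * (v * ((M+2)^3 * y / (2*(2*M+3))))
            + 64 * (N+1) * (v * ((M+1)^3 * ((M+2)^3 * y / (2*(2*M+3))) / (2*(2*M+1)))))
      = (x+1)^3 * (16 * (x+1)^3 - (72*N+120) * (x+1)^2 + (104*N^2+356*N+296) * (x+1)
          - (48*N^3+248*N^2+416*N+224)) * (2*(2*x+1) * v / (x+1)^3)
          * ((M+2)^3 * y / (2*(2*M+3))) / (4 * (2*M+1))" for v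
    using nz unfolding N by (simp add: divide_simps) Groebner_Basis.algebra
  then show ?case
    using Suc.IH Suc.prems
    by (simp only: sum.lessThan_Suc Suc_leD sub den x_def[symmetric] uK u0 u1 y_def[symmetric])
qed

section \<open>The scaled sequence and a second sum with the same recurrence\<close>

definition domb_scaled :: "nat \<Rightarrow> rat" where
  "domb_scaled n = of_nat (Domb n) / 16 ^ n"

definition domb_summand :: "nat \<Rightarrow> rat" where
  "domb_summand k = (- 1) ^ k * fact (2 * k) / (16 ^ k * fact k ^ 5)"

text \<open>In binomial form the summand is \<open>(-1/16)^k\<close> times
  \<open>(n + 2k choose 3k) (2k choose k)^2 (3k choose k)\<close>. The factor
  \<open>domb_summand k\<close> is kept free of \<open>n\<close>, so that it can be pulled out when
  summing over \<open>n\<close>.\<close>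

definition domb_binomial :: "nat \<Rightarrow> rat" where
  "domb_binomial n = (\<Sum>k\<le>n. domb_summand k * fact (n + 2 * k) / fact (n - k))"

text \<open>The telescoped sum stops at \<open>k = n\<close>; the remaining terms
  \<open>k = n + 1\<close> and \<open>k = n + 2\<close> of the longer convolutions cancel its
  boundary value. Multiplying by \<open>n!^2 (n + 1)^2 / (32 * 16^n)\<close> passes from the
  convolution to the scaled numbers.\<close>

lemma domb_scaled_recurrence:
  "8 * (of_nat n + 2) ^ 3 * domb_scaled (n + 2)
   = (2 * of_nat n + 3) * (5 * (of_nat n)\<^sup>2 + 15 * of_nat n + 12) * domb_scaled (n + 1)
     - 2 * (of_nat n + 1) ^ 3 * domb_scaled n"
proof -
  define N where "N = (of_nat n :: rat)"
  define E where "E n = (\<Sum>k\<le>n. domb_weight k * domb_weight (n - k))" for n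
  define w where "w = domb_weight (n + 1)"
  define S where "S i = (\<Sum>k<n+1. domb_weight k * domb_weight (n+i-k))" for i
  have w2: "domb_weight (Suc (Suc n)) = 2 * (2*N+3) * w / (N+2)^3"
    using domb_weight_Suc[of "Suc n"] by (simp add: N_def w_def field_simps add_nonneg_eq_0_iff)
  have one: "domb_weight (Suc 0) = 2"
    by (simp add: domb_weight_def)
  have nz: "N + 2 \<noteq> 0" "N + 1 \<noteq> 0"
    by (simp_all add: N_def add_nonneg_eq_0_iff)
  have E: "E n = S 0" "E (n+1) = S 1 + w" "E (n+2) = S 2 + 2 * w + domb_weight (Suc (Suc n))"
    by (simp_all add: E_def S_def w_def one lessThan_Suc_atMost)
  have "(N+2)^5 * S 2 - 2 * ((2*N+3) * (5*N^2+15*N+12)) * S 1 + 64 * (N+1) * S 0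
        = (N+1)^3 * (16 * (N+1) ^ 3 - (72*N+120) * (N+1) ^ 2 + (104*N^2+356*N+296) * (N+1)
          - (48*N^3+248*N^2+416*N+224)) * w / 2"
    \<comment> \<open>At \<open>K = n + 1\<close> the certificate has denominator \<open>4\<close>
      and the weight \<open>domb_weight 1 = 2\<close>, whence the final division by
      \<open>2\<close>.\<close>
    using domb_weight_telescope[of "n+1" n] one
    unfolding S_def N_def[symmetric] sum.distrib sum_subtractf sum_distrib_left[symmetric] w_def
    by (simp add: N_def del: sum.lessThan_Suc) (simp add: add.commute)
  then have rec: "(N+2)^5 * E (n+2) - 2 * ((2*N+3) * (5*N^2+15*N+12)) * E (n+1) + 64 * (N+1) * E n = 0"
    unfolding E w2 by (simp add: divide_simps nz) Groebner_Basis.algebra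
  have D: "domb_scaled j = (fact j)\<^sup>2 * E j / 16 ^ j" for j
    by (simp add: domb_scaled_def Domb_conv_weight E_def)
  have f: "fact (n+1) = (N+1) * (fact n :: rat)" "fact (n+2) = (N+2) * (N+1) * (fact n :: rat)"
    by (simp_all add: N_def algebra_simps)
  have "8 * (N+2)^3 * domb_scaled (n+2) - (2*N+3) * (5*N^2+15*N+12) * domb_scaled (n+1)
     + 2 * (N+1)^3 * domb_scaled n =
      (fact n)\<^sup>2 * (N+1)\<^sup>2 / (32 * 16 ^ n) *
      ((N+2)^5 * E (n+2) - 2 * ((2*N+3) * (5*N^2+15*N+12)) * E (n+1) + 64 * (N+1) * E n)"
    unfolding D f power_add by (simp add: divide_simps) Groebner_Basis.algebra
  with rec show ?thesis
    by (simp add: N_def)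
qed

lemma domb_summand_Suc:
  "domb_summand (Suc k) = - (2 * of_nat k + 1) * domb_summand k / (8 * (of_nat k + 1) ^ 4)"
proof -
  have "(fact (2 * Suc k) :: rat) = (2 * of_nat k + 2) * (2 * of_nat k + 1) * fact (2 * k)"
    by (simp add: algebra_simps)
  moreover have "(fact (Suc k) :: rat) = (of_nat k + 1) * fact k"
    by simp
  moreover have "(of_nat k + 1 :: rat) \<noteq> 0"
    by (simp add: add_nonneg_eq_0_iff)
  ultimately show ?thesis
    unfolding domb_summand_def
    by (simp add: divide_simps del: fact_Suc) (simp add: algebra_simps power_numeral_reduce)
qed

lemma domb_binomial_telescope:
  fixes n K :: nat
  defines "N \<equiv> of_nat n :: rat"
  assumes "K \<le> n + 1"
  shows "(\<Sum>k<K. 8 * (N+2)^3 * (domb_summand k * fact (n+2+2*k) / fact (n+2-k))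
            - (2*N+3) * (5*N^2+15*N+12) * (domb_summand k * fact (n+1+2*k) / fact (n+1-k))
            + 2 * (N+1)^3 * (domb_summand k * fact (n+2*k) / fact (n-k)))
     = - (of_nat K ^ 4) * (72*N+120) * domb_summand K * fact (n+2*K) / fact (n+2-K)"
  using assms(2)
proof (induction K)
  case 0
  then show ?case by simp
next
  case (Suc K)
  then obtain m where n: "n = K + m"
    using le_Suc_ex by auto
  define M x where "M = (of_nat m :: rat)" and "x = (of_nat K :: rat)"
  have nz: "M+1 \<noteq> 0" "M+2 \<noteq> 0" "x + 1 \<noteq> 0"
    unfolding M_def x_def by (simp_all add: add_nonneg_eq_0_iff)
  have N: "N = x + M"
    by (simp add: N_def n x_def M_def)
  have sub: "n+2-K = Suc (Suc m)" "n+1-K = Suc m" "n-K = m" "n+2-Suc K = Suc m" "of_nat (Suc K) = x + 1"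
    by (auto simp: n x_def)
  have f: "(fact (n+2+2*K) :: rat) = (N+2*x+2)*(N+2*x+1)*fact (n+2*K)"
    "(fact (n+1+2*K) :: rat) = (N+2*x+1)*fact (n+2*K)"
    "(fact (n+2*Suc K) :: rat) = (N+2*x+2)*(N+2*x+1)*fact (n+2*K)"
    "(fact (Suc m) :: rat) = (M+1) * fact m" "(fact (Suc (Suc m)) :: rat) = (M+2) * (M+1) * fact m"
    by (simp_all add: N_def x_def M_def algebra_simps)
  have "- (x^4) * (72*N+120) * c * a / ((M+2)*(M+1)*b)
        + (8 * (N+2)^3 * (c * ((N+2*x+2)*(N+2*x+1)*a) / ((M+2)*(M+1)*b))
            - (2*N+3) * (5*N^2+15*N+12) * (c * ((N+2*x+1)*a) / ((M+1)*b))
            + 2 * (N+1)^3 * (c * a / b))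
      = - ((x+1)^4) * (72*N+120) * (- (2*x+1) * c / (8 * (x+1)^4))
          * ((N+2*x+2)*(N+2*x+1)*a) / ((M+1)*b)" if "b \<noteq> 0" for a b c
    unfolding N by (simp add: divide_simps nz that) Groebner_Basis.algebra
  then show ?case
    using Suc.IH Suc.prems
    by (simp only: sum.lessThan_Suc Suc_leD sub x_def[symmetric] f domb_summand_Suc fact_nonzero
      not_False_eq_True)
qed

text \<open>As for the scaled Domb numbers: telescoping over \<open>k \<le> n\<close> leaves a
  boundary value that the terms \<open>k = n + 1\<close> and \<open>k = n + 2\<close>
  cancel.\<close>

lemma domb_binomial_recurrence:
  "8 * (of_nat n + 2) ^ 3 * domb_binomial (n + 2)
   = (2 * of_nat n + 3) * (5 * (of_nat n)\<^sup>2 + 15 * of_nat n + 12) * domb_binomial (n + 1)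
     - 2 * (of_nat n + 1) ^ 3 * domb_binomial n"
proof -
  define N where "N = (of_nat n :: rat)"
  define c where "c = domb_summand (n + 1)"
  \<comment> \<open>All factorials in the boundary terms are multiples of \<open>(3n + 2)!\<close>,
    the value of \<open>fact (n + 2 * k)\<close> at \<open>k = n + 1\<close>.\<close>
  define A where "A = (fact (3 * n + 2) :: rat)"
  define S where "S i = (\<Sum>k<n+1. domb_summand k * fact (n+i+2*k) / fact (n+i-k))" for i
  have c2: "domb_summand (Suc (Suc n)) = - (2*N+3) * c / (8 * (N+2)^4)"
    using domb_summand_Suc[of "Suc n"] by (simp add: N_def c_def algebra_simps)
  have nz: "N + 2 \<noteq> 0" "N + 1 \<noteq> 0"
    by (simp_all add: N_def add_nonneg_eq_0_iff)
  have f: "(fact (n + 1 + 2 * (n + 1)) :: rat) = (3*N+3) * A"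
    "(fact (n + 2 + 2 * (n + 1)) :: rat) = (3*N+4) * (3*N+3) * A"
    "(fact (n + 2 + 2 * (n + 2)) :: rat) = (3*N+6) * (3*N+5) * (3*N+4) * (3*N+3) * A"
    "(fact (n + 2 * (n + 1)) :: rat) = A"
  proof -
    have "n + 1 + 2 * (n + 1) = Suc (3*n+2)" "n + 2 + 2 * (n + 1) = Suc (Suc (3*n+2))"
      "n + 2 + 2 * (n + 2) = Suc (Suc (Suc (Suc (3*n+2))))" "n + 2 * (n + 1) = 3*n+2"
      by simp_all
    then show "(fact (n + 1 + 2 * (n + 1)) :: rat) = (3*N+3) * A"
    "(fact (n + 2 + 2 * (n + 1)) :: rat) = (3*N+4) * (3*N+3) * A"
    "(fact (n + 2 + 2 * (n + 2)) :: rat) = (3*N+6) * (3*N+5) * (3*N+4) * (3*N+3) * A"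
    "(fact (n + 2 * (n + 1)) :: rat) = A"
      unfolding A_def N_def by (simp_all only: fact_Suc) (simp_all add: algebra_simps)
  qed
  have E: "domb_binomial n = S 0" "domb_binomial (n+1) = S 1 + c * ((3*N+3) * A)"
    "domb_binomial (n+2) = S 2 + c * ((3*N+4) * (3*N+3) * A)
      + domb_summand (Suc (Suc n)) * ((3*N+6) * (3*N+5) * (3*N+4) * (3*N+3) * A)"
  proof -
    show "domb_binomial n = S 0"
      by (simp add: domb_binomial_def S_def lessThan_Suc_atMost)
    have sum1: "(\<Sum>k\<le>n+1. g k) = (\<Sum>k<n+1. g k) + g (n+1)" for g :: "nat \<Rightarrow> rat"
      by (simp add: lessThan_Suc_atMost)
    have sum2: "(\<Sum>k\<le>n+2. g k) = (\<Sum>k<n+1. g k) + g (n+1) + g (n+2)" for g :: "nat \<Rightarrow> rat"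
      by (simp add: lessThan_Suc_atMost)
    have sub: "n + 1 - (n + 1) = 0" "n + 2 - (n + 1) = 1" "n + 2 - (n + 2) = 0" "Suc (Suc n) = n + 2"
      by simp_all
    show "domb_binomial (n+1) = S 1 + c * ((3*N+3) * A)"
      "domb_binomial (n+2) = S 2 + c * ((3*N+4) * (3*N+3) * A)
        + domb_summand (Suc (Suc n)) * ((3*N+6) * (3*N+5) * (3*N+4) * (3*N+3) * A)"
      unfolding domb_binomial_def S_def c_def sum1 sum2 f sub by (simp_all only: fact_0 fact_1 div_by_1)
  qed
  have "8 * (N+2)^3 * S 2 - (2*N+3) * (5*N^2+15*N+12) * S 1 + 2 * (N+1)^3 * S 0
     = - ((N+1) ^ 4) * (72*N+120) * c * A"
    using domb_binomial_telescope[of "n+1" n]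
    unfolding f c_def[symmetric] N_def[symmetric] S_def
      sum.distrib sum_subtractf sum_distrib_left[symmetric]
    by (simp add: N_def del: fact_Suc sum.lessThan_Suc) (simp add: add.commute)
  then show ?thesis
    unfolding E c2 N_def[symmetric] by (simp add: divide_simps nz) Groebner_Basis.algebra
qed

lemma domb_scaled_0: "domb_scaled 0 = 1"
  by (simp add: domb_scaled_def Domb_def)

lemma domb_scaled_1: "domb_scaled 1 = 1 / 4"
  by (simp add: domb_scaled_def Domb_def)

text \<open>Both sequences start with \<open>1\<close> and \<open>1/4\<close> and obey the same
  second-order recurrence, whose leading coefficient \<open>8 (n + 2)^3\<close> never
  vanishes.\<close>

lemma domb_scaled_eq_domb_binomial: "domb_scaled n = domb_binomial n"
proof (induction n rule: induct_nat_012)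
  case 0
  then show ?case by (simp add: domb_scaled_0 domb_binomial_def domb_summand_def)
next
  case 1
  then show ?case
    using domb_scaled_1 by (simp add: domb_binomial_def domb_summand_def fact_numeral)
next
  case (ge2 n)
  have nz: "8 * (of_nat n + 2 :: rat) ^ 3 \<noteq> 0"
    by (simp add: add_nonneg_eq_0_iff)
  have "8 * (of_nat n + 2) ^ 3 * domb_scaled (n+2) = 8 * (of_nat n + 2) ^ 3 * domb_binomial (n+2)"
    unfolding domb_scaled_recurrence domb_binomial_recurrence using ge2 by simp
  with nz show ?case by simp
qed

section \<open>Reduction to a sum with weight \<open>3n + 1\<close>\<close>

text \<open>Summation by parts against the recurrence, checked by induction on \<open>N\<close>. The
  boundary terms carry \<open>(N + 1)^2\<close> and \<open>(N + 1)^3\<close>, which become powers of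
  \<open>p\<close> at \<open>N = p - 1\<close>.\<close>

lemma sum_domb_scaled_rational:
  assumes "N \<ge> 1"
  shows "(\<Sum>n=2..N. of_nat ((n+1)^2) / of_nat (n*(n-1)) * domb_scaled n)
    = 3/2 + (\<Sum>n\<le>N. (3 * of_nat n + 1) * domb_scaled n) / 2
      + (of_nat N + 1)^2 * domb_scaled N - 4 * (of_nat N + 1)^3 / of_nat N * domb_scaled (N + 1)"
  using assms
proof (induction N rule: nat_induct_at_least)
  case base
  have "domb_scaled 2 = 7/64"
    using domb_scaled_recurrence[of 0] domb_scaled_0 domb_scaled_1 by (simp add: numeral_2_eq_2)
  then show ?case
    using domb_scaled_0 domb_scaled_1 by (simp add: field_simps numeral_2_eq_2)
next
  case (Suc n)
  define N where "N = (of_nat n :: rat)"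
  have nz: "N \<noteq> 0" "N + 1 \<noteq> 0" "N + 2 \<noteq> 0"
    using Suc.hyps by (simp_all add: N_def add_nonneg_eq_0_iff)
  have rec: "domb_scaled (Suc n + 1) = ((2*N+3) * (5*N^2+15*N+12) * domb_scaled (Suc n)
     - 2 * (N+1)^3 * domb_scaled n) / (8 * (N+2)^3)"
    using domb_scaled_recurrence[of n] by (simp add: N_def field_simps add_nonneg_eq_0_iff)
  have cast: "(of_nat ((Suc n+1)^2) :: rat) = (N+2)^2" "(of_nat (Suc n*(Suc n-1)) :: rat) = (N+1)*N"
    "(of_nat (Suc n) :: rat) = N + 1" "n + 1 = Suc n" "N + 1 + 1 = N + 2"
    by (simp_all add: N_def algebra_simps)
  \<comment> \<open>Here \<open>a\<close> and \<open>b\<close> stand for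
    \<open>domb_scaled (Suc n)\<close> and \<open>domb_scaled n\<close>. The identity is linear in
    the free values \<open>x\<close>, \<open>y\<close>, \<open>a\<close>, \<open>b\<close>, since
    the recurrence has eliminated the next value.\<close>
  have "(N+2)^2 / ((N+1)*N) * a + (x + y / 2 + (N+1)^2 * b - 4 * (N+1)^3 / N * a)
      = x + (y + (3*(N+1)+1) * a) / 2 + (N+2)^2 * a
        - 4 * (N+2)^3 / (N+1) * (((2*N+3) * (5*N^2+15*N+12) * a - 2 * (N+1)^3 * b) / (8 * (N+2)^3))"
    for x y a b
    using nz by (simp add: divide_simps) Groebner_Basis.algebra
  moreover have "2 \<le> Suc n"
    using Suc.hyps by simp
  ultimately show ?case
    using Suc.IH
    by (simp only: sum.nat_ivl_Suc' sum.atMost_Suc rec cast N_def[symmetric])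
qed

text \<open>With \<open>G n = (3n - 1) (n + 2k)! / (n - k - 1)!\<close>, understood as
  \<open>0\<close> at \<open>n = k\<close>, one has
  \<open>G (n + 1) - G n = (3k + 2) (3n + 1) (n + 2k)! / (n - k)!\<close>, so the sum telescopes.
  The weight \<open>3n + 1\<close> is what makes this antidifference exist.\<close>

lemma sum_linear_fact_ratio:
  "(\<Sum>n=k..k+j. (3 * of_nat n + 1) * fact (n + 2*k) / fact (n - k))
   = (3 * of_nat (k+j+1) - 1) * fact (k+j+1 + 2*k) / (fact j * (3 * of_nat k + 2) :: rat)"
proof (induction j)
  case 0
  have "(3 * of_nat k + 2 :: rat) \<noteq> 0"
    by (simp add: add_nonneg_eq_0_iff)
  then show ?case by (simp add: divide_simps) (simp add: algebra_simps)
next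
  case (Suc j)
  define x J where "x = (of_nat k :: rat)" and "J = (of_nat j :: rat)"
  have nz: "3*x+2 \<noteq> 0" "J+1 \<noteq> 0"
    by (simp_all add: x_def J_def add_nonneg_eq_0_iff)
  have f: "(fact (k+Suc j+1+2*k) :: rat) = (3*x+J+2) * fact (k+j+1+2*k)"
    "k+Suc j+2*k = k+j+1+2*k" "(fact (Suc j) :: rat) = (J+1) * fact j"
    "(of_nat (k+j+1) :: rat) = x+J+1" "(of_nat (k+Suc j+1) :: rat) = x+J+2"
    "(of_nat (k+Suc j) :: rat) = x+J+1" "k + Suc j - k = Suc j"
    by (simp_all add: x_def J_def algebra_simps)
  have "(3*(x+J+1)-1) * a / (b * (3*x+2)) + (3*(x+J+1)+1) * a / ((J+1)*b)
      = (3*(x+J+2)-1) * ((3*x+J+2) * a) / ((J+1)*b*(3*x+2))" if "b \<noteq> 0" for a b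
    using nz that by (simp add: divide_simps) Groebner_Basis.algebra
  moreover have "(\<Sum>n=k..k+Suc j. g n) = (\<Sum>n=k..k+j. g n) + g (k + Suc j)" for g :: "nat \<Rightarrow> rat"
    by simp
  ultimately show ?case
    using Suc.IH by (simp only: f x_def[symmetric] fact_nonzero not_False_eq_True)
qed

text \<open>After inserting the second expression and exchanging the sums, each \<open>k\<close>
  leaves an inner sum over \<open>k \<le> n < p\<close>, which \<open>sum_linear_fact_ratio\<close>
  evaluates with \<open>j = p - k - 1\<close>.\<close>

lemma sum_linear_domb_scaled:
  "(\<Sum>n<p. (3 * of_nat n + 1) * domb_scaled n)
   = (3 * of_nat p - 1) *
     (\<Sum>k<p. domb_summand k * (fact (p + 2*k) / fact (p - k - 1)) / (3 * of_nat k + 2))"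
proof -
  define g where "g n k = domb_summand k * ((3 * of_nat n + 1) * fact (n + 2*k) / fact (n - k))" for n k
  have "(\<Sum>n<p. (3 * of_nat n + 1) * domb_scaled n) = (\<Sum>n<p. \<Sum>k\<in>{k\<in>{..<p}. k \<le> n}. g n k)"
  proof (rule sum.cong)
    fix n assume "n \<in> {..<p}"
    then have "{k\<in>{..<p}. k \<le> n} = {..n}" by auto
    then show "(3 * of_nat n + 1) * domb_scaled n = (\<Sum>k\<in>{k\<in>{..<p}. k \<le> n}. g n k)"
      by (simp add: domb_scaled_eq_domb_binomial domb_binomial_def g_def sum_distrib_left algebra_simps)
  qed simp
  also have "\<dots> = (\<Sum>k<p. \<Sum>n\<in>{n\<in>{..<p}. k \<le> n}. g n k)"
    by (rule sum.swap_restrict) auto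
  also have "\<dots> = (\<Sum>k<p. (3 * of_nat p - 1) *
      (domb_summand k * (fact (p + 2*k) / fact (p - k - 1)) / (3 * of_nat k + 2)))"
  proof (rule sum.cong)
    fix k assume "k \<in> {..<p}"
    then obtain j where p: "p = k + j + 1"
      by (auto dest: less_imp_Suc_add)
    then have "{n\<in>{..<p}. k \<le> n} = {k..k+j}" by auto
    then have "(\<Sum>n\<in>{n\<in>{..<p}. k \<le> n}. g n k) =
        domb_summand k * (\<Sum>n=k..k+j. (3 * of_nat n + 1) * fact (n + 2*k) / fact (n - k))"
      by (simp add: g_def sum_distrib_left)
    also have "\<dots> = domb_summand k *
        ((3 * of_nat p - 1) * fact (p + 2*k) / (fact j * (3 * of_nat k + 2)))"
      unfolding sum_linear_fact_ratio p ..
    also have "j = p - k - 1"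
      using p by simp
    finally show "(\<Sum>n\<in>{n\<in>{..<p}. k \<le> n}. g n k) = (3 * of_nat p - 1) *
      (domb_summand k * (fact (p + 2*k) / fact (p - k - 1)) / (3 * of_nat k + 2))"
      by simp
  qed simp
  finally show ?thesis
    by (simp add: sum_distrib_left)
qed

section \<open>Rationals with denominator prime to p\<close>

text \<open>For prime \<open>p\<close> this is the localization of the integers at \<open>p\<close>.
  As a set with closure rules it lets the witnesses in \<open>rat_cong_mod\<close> be built
  compositionally.\<close>

definition p_integral :: "nat \<Rightarrow> rat set" where
  "p_integral p = {of_int a / of_int b | a b. b \<noteq> 0 \<and> coprime b (int p)}"

lemma rat_cong_mod_iff: "rat_cong_mod p x y m \<longleftrightarrow> (\<exists>z\<in>p_integral p. x - y = of_int m * z)"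
  unfolding rat_cong_mod_def p_integral_def by blast

lemma p_integral_of_int [simp]: "of_int a \<in> p_integral p"
  unfolding p_integral_def by (intro CollectI exI[of _ a] exI[of _ 1]) auto

lemma p_integral_of_nat [simp]: "of_nat a \<in> p_integral p"
  using p_integral_of_int[of "int a"] by simp

lemma p_integral_1 [simp]: "1 \<in> p_integral p"
  using p_integral_of_nat[of 1] by simp

lemma p_integral_0 [simp]: "0 \<in> p_integral p"
  using p_integral_of_nat[of 0] by simp

lemma p_integral_numeral [simp]: "numeral n \<in> p_integral p"
  using p_integral_of_nat[of "numeral n"] by simp

lemma p_integral_fact [simp]: "fact n \<in> p_integral p"
  using p_integral_of_nat[of "fact n"] by simp

lemma p_integral_add [simp]:
  assumes "x \<in> p_integral p" "y \<in> p_integral p"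
  shows "x + y \<in> p_integral p"
proof -
  from assms obtain a b c d :: int where "x = of_int a / of_int b" "b \<noteq> 0" "coprime b (int p)"
    "y = of_int c / of_int d" "d \<noteq> 0" "coprime d (int p)"
    unfolding p_integral_def by blast
  then have "x + y = of_int (a*d + c*b) / of_int (b*d) \<and> b*d \<noteq> 0 \<and> coprime (b*d) (int p)"
    by (simp add: add_frac_eq)
  then show ?thesis unfolding p_integral_def by blast
qed

lemma p_integral_mult [simp]:
  assumes "x \<in> p_integral p" "y \<in> p_integral p"
  shows "x * y \<in> p_integral p"
proof -
  from assms obtain a b c d :: int where "x = of_int a / of_int b" "b \<noteq> 0" "coprime b (int p)"
    "y = of_int c / of_int d" "d \<noteq> 0" "coprime d (int p)"
    unfolding p_integral_def by blast
  then have "x * y = of_int (a*c) / of_int (b*d) \<and> b*d \<noteq> 0 \<and> coprime (b*d) (int p)"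
    by simp
  then show ?thesis unfolding p_integral_def by blast
qed

lemma p_integral_minus [simp]: "x \<in> p_integral p \<Longrightarrow> - x \<in> p_integral p"
  using p_integral_mult[of "of_int (-1)" p x, OF p_integral_of_int] by simp

lemma p_integral_diff [simp]:
  "x \<in> p_integral p \<Longrightarrow> y \<in> p_integral p \<Longrightarrow> x - y \<in> p_integral p"
  using p_integral_add[of x p "- y"] by simp

lemma p_integral_power [simp]: "x \<in> p_integral p \<Longrightarrow> x ^ n \<in> p_integral p"
  by (induction n) auto

lemma p_integral_sum [simp]: "(\<And>i. i \<in> A \<Longrightarrow> f i \<in> p_integral p) \<Longrightarrow> sum f A \<in> p_integral p"
  by (induction A rule: infinite_finite_induct) auto

lemma p_integral_prod [simp]: "(\<And>i. i \<in> A \<Longrightarrow> f i \<in> p_integral p) \<Longrightarrow> prod f A \<in> p_integral p"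
  by (induction A rule: infinite_finite_induct) auto

lemma p_integral_divide_of_nat:
  assumes "prime p" "\<not> p dvd b" "x \<in> p_integral p"
  shows "x / of_nat b \<in> p_integral p"
proof -
  have "coprime (int b) (int p)"
    using assms prime_imp_coprime coprime_commute by (metis coprime_int_iff)
  moreover have "b \<noteq> 0"
    using assms(2) by (metis dvd_0_right)
  ultimately have "of_int 1 / of_int (int b) \<in> p_integral p"
    unfolding p_integral_def by (intro CollectI exI[of _ 1] exI[of _ "int b"]) auto
  from p_integral_mult[OF assms(3) this] show ?thesis by simp
qed

lemma rat_cong_mod_refl [simp]: "rat_cong_mod p x x m"
  unfolding rat_cong_mod_iff by (intro bexI[of _ 0]) auto

lemma rat_cong_mod_trans [trans]:
  assumes "rat_cong_mod p x y m" "rat_cong_mod p y z m"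
  shows "rat_cong_mod p x z m"
proof -
  from assms obtain a b where "a \<in> p_integral p" "x - y = of_int m * a" "b \<in> p_integral p" "y - z = of_int m * b"
    unfolding rat_cong_mod_iff by blast
  then show ?thesis
    unfolding rat_cong_mod_iff by (intro bexI[of _ "a + b"]) (auto simp: algebra_simps)
qed

lemma rat_cong_mod_add:
  assumes "rat_cong_mod p x y m" "rat_cong_mod p x' y' m"
  shows "rat_cong_mod p (x + x') (y + y') m"
proof -
  from assms obtain a b where "a \<in> p_integral p" "x - y = of_int m * a" "b \<in> p_integral p" "x' - y' = of_int m * b"
    unfolding rat_cong_mod_iff by blast
  then show ?thesis
    unfolding rat_cong_mod_iff by (intro bexI[of _ "a + b"]) (auto simp: algebra_simps)
qed

text \<open>The difference splits as \<open>(x - y) * x' + y * (x' - y')\<close>. Congruent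
  rationals may both have denominators divisible by \<open>p\<close>, hence the integrality
  assumptions on the cofactors \<open>x'\<close> and \<open>y\<close>.\<close>

lemma rat_cong_mod_mult:
  assumes "rat_cong_mod p x y m" "rat_cong_mod p x' y' m" "x' \<in> p_integral p" "y \<in> p_integral p"
  shows "rat_cong_mod p (x * x') (y * y') m"
proof -
  from assms obtain a b where ab: "a \<in> p_integral p" "x - y = of_int m * a" "b \<in> p_integral p" "x' - y' = of_int m * b"
    unfolding rat_cong_mod_iff by blast
  have "x * x' - y * y' = (x - y) * x' + y * (x' - y')"
    by (simp add: algebra_simps)
  also have "\<dots> = of_int m * (a * x' + y * b)"
    unfolding ab by (simp add: algebra_simps)
  finally show ?thesis
    unfolding rat_cong_mod_iff using ab assms(3,4) by (intro bexI[of _ "a * x' + y * b"]) auto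
qed

lemma rat_cong_mod_sum:
  "(\<And>i. i \<in> A \<Longrightarrow> rat_cong_mod p (f i) (g i) m) \<Longrightarrow> rat_cong_mod p (sum f A) (sum g A) m"
  by (induction A rule: infinite_finite_induct) (auto intro: rat_cong_mod_add)

lemma rat_cong_mod_prod:
  assumes "\<And>i. i \<in> A \<Longrightarrow> rat_cong_mod p (f i) (g i) m" "\<And>i. i \<in> A \<Longrightarrow> f i \<in> p_integral p"
    "\<And>i. i \<in> A \<Longrightarrow> g i \<in> p_integral p"
  shows "rat_cong_mod p (prod f A) (prod g A) m"
  using assms by (induction A rule: infinite_finite_induct) (auto intro!: rat_cong_mod_mult)

section \<open>Alternating sums\<close>

text \<open>Up to sign this is the \<open>h\<close>-th finite difference at \<open>0\<close> of a
  polynomial of degree \<open>card I < h\<close>. The induction removes one linear factor at a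
  time.\<close>

lemma alternating_binomial_sum_prod_eq_0:
  fixes f :: "'a \<Rightarrow> rat"
  assumes "finite I" "card I < h"
  shows "(\<Sum>k\<le>h. (-1)^k * of_nat (h choose k) * (\<Prod>i\<in>I. of_nat k + f i)) = 0"
  using assms
proof (induction I arbitrary: h f rule: finite_induct)
  case empty
  then show ?case by (simp add: choose_alternating_sum)
next
  case (insert j I)
  then obtain m where h: "h = Suc m" "card I < m"
    by (cases h) auto
  have "(\<Sum>k\<le>h. (-1)^k * of_nat (h choose k) * (\<Prod>i\<in>insert j I. of_nat k + f i))
     = f j * (\<Sum>k\<le>h. (-1)^k * of_nat (h choose k) * (\<Prod>i\<in>I. of_nat k + f i))
       + (\<Sum>k\<le>h. (-1)^k * of_nat (k * (h choose k)) * (\<Prod>i\<in>I. of_nat k + f i))"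
    using insert.hyps by (simp add: sum_distrib_left sum.distrib[symmetric] algebra_simps)
  also have "(\<Sum>k\<le>h. (-1)^k * of_nat (h choose k) * (\<Prod>i\<in>I. of_nat k + f i)) = 0"
    using insert.IH[of h] h by simp
  \<comment> \<open>The factor \<open>k\<close> kills the term at \<open>0\<close> and is absorbed
    into the binomial coefficient. The index shift turns \<open>f\<close> into \<open>1 + f\<close>,
    which is why the induction keeps \<open>f\<close> and \<open>h\<close> arbitrary.\<close>
  also have "(\<Sum>k\<le>h. (-1)^k * of_nat (k * (h choose k)) * (\<Prod>i\<in>I. of_nat k + f i))
     = (\<Sum>k\<le>m. (-1)^Suc k * of_nat (Suc k * (Suc m choose Suc k)) * (\<Prod>i\<in>I. of_nat (Suc k) + f i))"
    unfolding h(1) sum.atMost_Suc_shift by simp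
  also have "\<dots> = - of_nat (Suc m) * (\<Sum>k\<le>m. (-1)^k * of_nat (m choose k) * (\<Prod>i\<in>I. of_nat k + (1 + f i)))"
    unfolding sum_distrib_left Suc_times_binomial of_nat_mult
    by (intro sum.cong) (simp_all add: algebra_simps)
  also have "\<dots> = 0"
    using insert.IH[of m "\<lambda>i. 1 + f i"] h by simp
  finally show ?case by simp
qed

lemma binomial_add_conv_prod: "of_nat ((h + k) choose k) = (\<Prod>i=1..h. of_nat k + of_nat i) / (fact h :: rat)"
proof (induction h)
  case 0
  then show ?case by simp
next
  case (Suc h)
  have "(of_nat (Suc h) :: rat) * of_nat ((Suc h + k) choose k) = of_nat (h + k + 1) * of_nat ((h + k) choose k)"
    using Suc_times_binomial_add[of h k] binomial_symmetric[of k "Suc h + k"] binomial_symmetric[of k "h + k"]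
      Suc_times_binomial[of h "h + k"]
    by (metis (no_types, lifting) add_Suc add_diff_cancel_right' le_add2 of_nat_mult Suc_eq_plus1)
  then have "of_nat ((Suc h + k) choose k) = (of_nat k + of_nat (Suc h)) * of_nat ((h + k) choose k) / (of_nat (Suc h) :: rat)"
    by (simp add: divide_simps algebra_simps)
  then show ?case
    unfolding Suc.IH by (simp add: divide_simps mult_ac)
qed

text \<open>Since \<open>a\<close> lies in \<open>{1..h}\<close>, \<open>k + a\<close> divides out
  of \<open>(k + 1) ... (k + h)\<close>, leaving a polynomial of degree \<open>h - 1\<close>.
  Equivalently, the shifted Legendre polynomial of degree \<open>h\<close> is orthogonal to
  \<open>x^(a - 1)\<close> on \<open>[0, 1]\<close>.\<close>

lemma alternating_legendre_sum_eq_0: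
  assumes "1 \<le> a" "a \<le> h"
  shows "(\<Sum>k\<le>h. (-1)^k * of_nat (h choose k) * of_nat ((h + k) choose k) / (of_nat (k + a) :: rat)) = 0"
proof -
  have "of_nat ((h + k) choose k) / (of_nat (k + a) :: rat)
      = (\<Prod>i\<in>{1..h} - {a}. of_nat k + of_nat i) / fact h" for k
    using assms unfolding binomial_add_conv_prod
    by (subst prod.remove[of _ a]) (auto simp: add_nonneg_eq_0_iff)
  then have "(\<Sum>k\<le>h. (-1)^k * of_nat (h choose k) * of_nat ((h + k) choose k) / (of_nat (k + a) :: rat))
     = (\<Sum>k\<le>h. (-1)^k * of_nat (h choose k) * (\<Prod>i\<in>{1..h} - {a}. of_nat k + of_nat i)) / fact h"
    unfolding sum_divide_distrib by (intro sum.cong) (simp_all flip: times_divide_eq_right)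
  also have "(\<Sum>k\<le>h. (-1)^k * of_nat (h choose k) * (\<Prod>i\<in>{1..h} - {a}. of_nat k + of_nat i)) = (0 :: rat)"
    using assms by (intro alternating_binomial_sum_prod_eq_0) auto
  finally show ?thesis by simp
qed

section \<open>The congruence\<close>

text \<open>The quotient is the product of the integers from \<open>p - k\<close> to
  \<open>p + 2k\<close>. Centering it at \<open>p\<close> isolates one factor \<open>p\<close> and
  makes the rest easy to reduce modulo \<open>p\<close>.\<close>

lemma fact_ratio_conv_prod:
  assumes "k < p"
  shows "(fact (p + 2*k) / fact (p - k - 1) :: rat)
    = of_nat p * (\<Prod>j=1..k. of_nat p - of_nat j) * (\<Prod>j=1..2*k. of_nat p + of_nat j)"
proof -
  have up: "(fact (p + m) :: rat) = fact p * (\<Prod>j=1..m. of_nat p + of_nat j)" for m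
    by (induction m) (simp_all add: mult_ac add_ac)
  have down: "(fact (p - 1) :: rat) = fact (p - k - 1) * (\<Prod>j=1..k. of_nat p - of_nat j)"
    using assms
  proof (induction k)
    case 0
    then show ?case by simp
  next
    case (Suc k)
    then obtain m where m: "p = k + m + 2"
      by (metis less_imp_Suc_add add_Suc_right add_Suc add_2_eq_Suc')
    then have "p - k - 1 = Suc m" "p - Suc k - 1 = m" "(of_nat p :: rat) - of_nat (Suc k) = of_nat (Suc m)"
      by auto
    then show ?case
      using Suc by (simp add: mult_ac)
  qed
  have "(fact p :: rat) = of_nat p * fact (p - 1)"
    using assms by (simp add: fact_reduce)
  then show ?thesis
    unfolding up down by simp
qed

text \<open>The left side is \<open>(2k choose k)^2 / 16^k\<close>. Passing from \<open>k\<close> to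
  \<open>k + 1\<close> multiplies it by \<open>(2k + 1)^2 / (4 (k + 1)^2)\<close> and the right side
  by \<open>((2k + 1)^2 - p^2) / (4 (k + 1)^2)\<close>; these factors agree modulo
  \<open>p\<close>.\<close>

lemma rat_cong_mod_central_binomial_square:
  assumes "prime p" "p = 2 * h + 1" "k \<le> h"
  shows "(fact (2*k))\<^sup>2 / (16 ^ k * fact k ^ 4) \<in> p_integral p \<and>
    rat_cong_mod p ((fact (2*k))\<^sup>2 / (16 ^ k * fact k ^ 4))
      ((-1)^k * of_nat (h choose k) * of_nat ((h + k) choose k)) (int p)"
  using assms(3)
proof (induction k)
  case 0
  then show ?case by simp
next
  case (Suc k)
  define x H where "x = (of_nat k :: rat)" and "H = (of_nat h :: rat)"
  define v where "v = (fact (2*k))\<^sup>2 / (16 ^ k * fact k ^ 4 :: rat)"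
  define q where "q = ((-1)^k * of_nat (h choose k) * of_nat ((h + k) choose k) :: rat)"
  define d where "d = 4 * (k + 1)\<^sup>2"
  have x1: "x + 1 \<noteq> 0"
    by (simp add: x_def add_nonneg_eq_0_iff)
  have d: "(of_nat d :: rat) = 4 * (x+1)^2"
    by (simp add: d_def x_def algebra_simps)
  have "\<not> p dvd d"
  proof
    assume "p dvd d"
    then have "p dvd 2 \<or> p dvd k + 1"
      using assms(1) prime_dvd_mult_iff prime_dvd_power_iff
      by (metis d_def prime_dvd_power mult_2 numeral_Bit0 power2_eq_square mult_2_right)
    then show False
      using assms(2) Suc.prems by (auto dest!: dvd_imp_le)
  qed
  note div_d = p_integral_divide_of_nat[OF assms(1) this]
  have f: "(fact (2 * Suc k) :: rat) = (2 * x + 2) * (2 * x + 1) * fact (2 * k)"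
    "(fact (Suc k) :: rat) = (x + 1) * fact k"
    by (simp_all add: x_def algebra_simps)
  have v': "(fact (2 * Suc k))\<^sup>2 / (16 ^ Suc k * fact (Suc k) ^ 4) = v * ((2*x+1)^2 / of_nat d)"
    unfolding f v_def d power_Suc using x1 by (simp add: divide_simps) Groebner_Basis.algebra
  have b1: "(of_nat (h choose Suc k) :: rat) = of_nat (h choose k) * (H - x) / (x + 1)"
  proof -
    have "Suc k * (h choose Suc k) = (h - k) * (h choose k)"
      by (metis (no_types) mult.commute binomial_absorb_comp Suc_times_binomial_eq binomial_absorption)
    then have "(of_nat (Suc k) :: rat) * of_nat (h choose Suc k) = of_nat (h - k) * of_nat (h choose k)"
      by (metis of_nat_mult)
    then show ?thesis
      using x1 Suc.prems by (simp add: x_def H_def of_nat_diff divide_simps mult_ac add_ac)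
  qed
  have b2: "(of_nat ((h + Suc k) choose Suc k) :: rat) = of_nat ((h + k) choose k) * (H + x + 1) / (x + 1)"
  proof -
    have "(of_nat (Suc k) :: rat) * of_nat (Suc (h + k) choose Suc k) = of_nat (Suc (h + k)) * of_nat ((h + k) choose k)"
      unfolding of_nat_mult[symmetric] Suc_times_binomial ..
    then show ?thesis
      using x1 by (simp add: x_def H_def divide_simps mult_ac add_ac)
  qed
  have P: "(of_nat p :: rat) = 2 * H + 1"
    by (simp add: assms(2) H_def)
  \<comment> \<open>Because \<open>2h + 1 = p\<close>, the product
    \<open>-4 (h - k) (h + k + 1)\<close> equals \<open>(2k + 1)^2 - p^2\<close>.\<close>
  have q': "(-1)^Suc k * of_nat (h choose Suc k) * of_nat ((h + Suc k) choose Suc k)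
      = q * (((2*x+1)^2 - of_nat p ^ 2) / of_nat d)"
    unfolding b1 b2 q_def d power_Suc P using x1 by (simp add: divide_simps) Groebner_Basis.algebra
  have xp: "x \<in> p_integral p"
    by (simp add: x_def)
  have "of_nat p ^ 2 / of_nat d = of_int (int p) * (of_nat p / of_nat d :: rat)"
    by (simp add: power2_eq_square)
  then have "rat_cong_mod p ((2*x+1)^2 / of_nat d) (((2*x+1)^2 - of_nat p ^ 2) / of_nat d) (int p)"
    unfolding rat_cong_mod_iff
    by (intro bexI[of _ "of_nat p / of_nat d"]) (auto simp: diff_divide_distrib intro: div_d)
  moreover have "(2*x+1)^2 / of_nat d \<in> p_integral p"
    using xp by (intro div_d) simp
  moreover have "v \<in> p_integral p" "rat_cong_mod p v q (int p)"
    using Suc unfolding v_def q_def by auto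
  moreover have "q \<in> p_integral p"
    by (simp add: q_def)
  ultimately show ?case
    unfolding v' q' by (intro conjI p_integral_mult rat_cong_mod_mult)
qed

lemma not_dvd_16_power_fact:
  fixes p :: nat
  assumes "prime p" "p > 2" "k < p"
  shows "\<not> p dvd 16 ^ n * fact k ^ m"
proof
  assume "p dvd 16 ^ n * fact k ^ m"
  then have "p dvd 16 ^ n \<or> p dvd fact k ^ m"
    using assms(1) prime_dvd_mult_iff by blast
  moreover have "(16 :: nat) ^ n = 2 ^ (4 * n)"
    by (simp add: power_mult)
  ultimately have "p dvd 2 \<or> p dvd fact k"
    using assms(1) prime_dvd_power by metis
  then show False
    using assms prime_dvd_fact_iff[of p k] by (auto dest: dvd_imp_le)
qed

text \<open>Three factors \<open>p\<close> appear: one from \<open>(2k)!\<close>, as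
  \<open>p \<le> 2k\<close>, and two from the factorial quotient, which contains both
  \<open>p\<close> and \<open>2p\<close>. The denominator \<open>3k + 2\<close> cancels at most one
  of them.\<close>

lemma domb_term_high:
  assumes "prime p" "3 < p" "p \<le> 2 * k" "k < p"
  shows "\<exists>z\<in>p_integral p.
    domb_summand k * (fact (p + 2*k) / fact (p - k - 1)) / (3 * of_nat k + 2) = of_nat p ^ 2 * z"
proof -
  define P where "P = (of_nat p :: rat)"
  define A where "A = (\<Prod>j=1..k. P - of_nat j)"
  define B where "B = (\<Prod>j\<in>{1..2*k}-{p}. P + of_nat j)"
  have kp: "\<not> p dvd 16 ^ k * fact k ^ 5"
    using assms by (intro not_dvd_16_power_fact) auto
  obtain e where e: "fact (2*k) = p * e"
    using dvd_fact[of p "2*k"] assms prime_gt_0_nat[of p] by (auto elim: dvdE)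
  have e': "(fact (2*k) :: rat) = P * of_nat e"
    by (metis P_def e of_nat_fact of_nat_mult)
  have B': "(\<Prod>j=1..2*k. P + of_nat j) = 2 * P * B"
    unfolding B_def by (subst prod.remove[of _ p]) (use assms in \<open>auto simp: P_def\<close>)
  \<comment> \<open>If \<open>p\<close> divides \<open>3k + 2 < 3p\<close>, the cofactor
    \<open>c\<close> is \<open>1\<close> or \<open>2\<close> and hence prime to
    \<open>p\<close>.\<close>
  have "P / of_nat (3*k+2) \<in> p_integral p"
  proof (cases "p dvd 3*k+2")
    case True
    then obtain c where c: "3*k+2 = p * c" by (elim dvdE)
    with assms have "p * c < p * 3" by linarith
    then have "c < p" using assms by simp
    moreover have "c > 0" using c by (cases c) auto
    ultimately have "\<not> p dvd c" by (auto dest: dvd_imp_le)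
    then have "1 / of_nat c \<in> p_integral p"
      using assms(1) by (intro p_integral_divide_of_nat) auto
    moreover have "P / of_nat (3*k+2) = 1 / of_nat c"
      unfolding c using assms by (simp add: P_def)
    ultimately show ?thesis by simp
  next
    case False
    then show ?thesis
      using assms(1) by (intro p_integral_divide_of_nat) (auto simp: P_def)
  qed
  moreover have "(-1)^k * of_nat e * A * 2 * B / of_nat (16 ^ k * fact k ^ 5) \<in> p_integral p"
    using assms(1) kp
    by (intro p_integral_divide_of_nat) (auto simp: A_def B_def P_def intro!: p_integral_mult p_integral_prod)
  ultimately have mem: "P / of_nat (3*k+2) * ((-1)^k * of_nat e * A * 2 * B / of_nat (16 ^ k * fact k ^ 5)) \<in> p_integral p"
    by (rule p_integral_mult)
  have "domb_summand k * (fact (p + 2*k) / fact (p - k - 1)) / (3 * of_nat k + 2)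
      = (-1)^k * (P * of_nat e) / of_nat (16 ^ k * fact k ^ 5) * (P * A * (2 * P * B)) / of_nat (3*k+2)"
    unfolding domb_summand_def fact_ratio_conv_prod[OF assms(4)] P_def[symmetric] A_def[symmetric] B' e'
    by (simp add: add.commute)
  also have "\<dots> = P ^ 2 * (P / of_nat (3*k+2) * ((-1)^k * of_nat e * A * 2 * B / of_nat (16 ^ k * fact k ^ 5)))"
    by (simp add: power2_eq_square mult_ac)
  finally show ?thesis
    using mem unfolding P_def by blast
qed

text \<open>Here only one factor \<open>p\<close> is visible. Modulo \<open>p\<close> its cofactor
  is \<open>(2k choose k)^2 / (16^k (3k + 2))\<close>, where \<open>3k + 2\<close> may be replaced
  by \<open>3 (k + a)\<close> because \<open>3a = p + 2\<close>.\<close>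

lemma domb_term_low:
  assumes "prime p" "p = 2 * h + 1" "p + 2 = 3 * a" "k \<le> h"
  shows "\<exists>y. domb_summand k * (fact (p + 2*k) / fact (p - k - 1)) / (3 * of_nat k + 2) = of_nat p * y \<and>
    rat_cong_mod p y ((-1)^k * of_nat (h choose k) * of_nat ((h + k) choose k) / of_nat (k + a) * (1/3)) (int p)"
proof -
  define P where "P = (of_nat p :: rat)"
  define A where "A = (\<Prod>j=1..k. P - of_nat j)"
  define B where "B = (\<Prod>j=1..2*k. P + of_nat j)"
  define q where "q = ((-1)^k * of_nat (h choose k) * of_nat ((h + k) choose k) :: rat)"
  define w where "w = ((-1)^k * fact (2*k) / of_nat (16 ^ k * fact k ^ 5 * (3*k+2)) :: rat)"
  have "a \<ge> 1" "h \<ge> 1"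
    using assms(2,3) prime_gt_1_nat[OF assms(1)] by auto
  then have "k + a < p" "p > 3"
    using assms prime_gt_1_nat[OF assms(1)] by presburger+
  \<comment> \<open>As \<open>3k + 2 < 2p\<close>, divisibility would force
    \<open>3k + 2 = p\<close>, contradicting \<open>p = 3a - 2\<close> modulo
    \<open>3\<close>.\<close>
  have p32: "\<not> p dvd 3*k+2"
  proof
    assume "p dvd 3*k+2"
    then obtain c where c: "3*k+2 = p * c" by (elim dvdE)
    then have "p * c < p * 2" using assms \<open>h \<ge> 1\<close> by linarith
    then have "c < 2" by simp
    with c have "3*k+2 = p" by (cases c) auto
    with assms(3) show False by presburger
  qed
  have p2: "\<not> p dvd 2" "\<not> p dvd 3"
    using \<open>p > 3\<close> by (auto dest: dvd_imp_le)
  have pk: "\<not> p dvd k + a"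
    using \<open>k + a < p\<close> \<open>a \<ge> 1\<close> by (auto dest: dvd_imp_le)
  have p16: "\<not> p dvd 16 ^ k * fact k ^ 5"
    using assms \<open>p > 3\<close> by (intro not_dvd_16_power_fact) auto
  have "\<not> p dvd 16 ^ k * fact k ^ 5 * (3*k+2)"
    using assms(1) p16 p32 prime_dvd_mult_iff by blast
  then have w: "w \<in> p_integral p"
    unfolding w_def using assms(1) by (intro p_integral_divide_of_nat) auto
  have shift: "rat_cong_mod p (P + x) x (int p)" for x
    unfolding rat_cong_mod_iff P_def by (intro bexI[of _ 1]) auto
  have A: "rat_cong_mod p A (\<Prod>j=1..k. - of_nat j) (int p)"
    unfolding A_def using shift[of "- of_nat j" for j]
    by (intro rat_cong_mod_prod) (auto simp: P_def)
  have B: "rat_cong_mod p B (\<Prod>j=1..2*k. of_nat j) (int p)"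
    unfolding B_def by (intro rat_cong_mod_prod shift) (auto simp: P_def)
  have A': "(\<Prod>j=1..k. - of_nat j) = ((-1)^k * fact k :: rat)"
    by (simp add: prod_uminus fact_prod)
  have B': "(\<Prod>j=1..2*k. of_nat j) = (fact (2*k) :: rat)"
    by (simp add: fact_prod)
  have "rat_cong_mod p (w * A * B) (w * ((-1)^k * fact k) * fact (2*k)) (int p)"
    using A B w unfolding A' B'
    by (intro rat_cong_mod_mult rat_cong_mod_refl) (auto simp: A_def B_def P_def)
  \<comment> \<open>The sign in \<open>w\<close> cancels the one produced by reducing the factors
    \<open>p - j\<close> to \<open>-j\<close>.\<close>
  also have "w * ((-1)^k * fact k) * fact (2*k)
      = (fact (2*k))\<^sup>2 / (16 ^ k * fact k ^ 4) * (1 / of_nat (3*k+2))"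
    unfolding w_def of_nat_mult by (simp add: divide_simps power_numeral_reduce mult_ac flip: power_mult_distrib)
  also have "rat_cong_mod p \<dots> (q * (1 / of_nat (3*(k+a)))) (int p)"
  proof (intro rat_cong_mod_mult)
    show "rat_cong_mod p ((fact (2*k))\<^sup>2 / (16 ^ k * fact k ^ 4)) q (int p)"
      using rat_cong_mod_central_binomial_square[OF assms(1,2,4)] unfolding q_def by blast
    show "1 / of_nat (3*k+2) \<in> p_integral p"
      using assms(1) p32 by (intro p_integral_divide_of_nat) auto
    show "q \<in> p_integral p"
      by (simp add: q_def)
    have "\<not> p dvd (3*k+2) * (3*(k+a))"
      using assms(1) p32 p2 pk by (simp only: prime_dvd_mult_iff) blast
    then have "1 / of_nat ((3*k+2) * (3*(k+a))) \<in> p_integral p"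
      using assms(1) by (intro p_integral_divide_of_nat) auto
    moreover have "1 / of_nat (3*k+2) - 1 / of_nat (3*(k+a)) = P * (1 / of_nat ((3*k+2) * (3*(k+a))))"
    proof -
      have "(of_nat (3*(k+a)) :: rat) = of_nat (3*k+2) + P"
        unfolding P_def of_nat_add[symmetric] using assms(3) by simp
      moreover have "(of_nat (3*(k+a)) :: rat) \<noteq> 0" "(of_nat (3*k+2) :: rat) \<noteq> 0"
        using \<open>a \<ge> 1\<close> by (simp_all only: of_nat_eq_0_iff) auto
      ultimately show ?thesis
        by (simp only: of_nat_mult[of "3*k+2" "3*(k+a)"]) (simp add: divide_simps)
    qed
    ultimately show "rat_cong_mod p (1 / of_nat (3*k+2)) (1 / of_nat (3*(k+a))) (int p)"
      unfolding rat_cong_mod_iff P_def of_int_of_nat_eq by blast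
  qed
  also have "q * (1 / of_nat (3*(k+a))) = q / of_nat (k + a) * (1/3)"
    by simp
  finally have cong: "rat_cong_mod p (w * A * B) (q / of_nat (k + a) * (1/3)) (int p)" .
  have "k < p"
    using assms by simp
  have "domb_summand k * (fact (p + 2*k) / fact (p - k - 1)) / (3 * of_nat k + 2)
      = of_nat p * (w * A * B)"
    unfolding domb_summand_def fact_ratio_conv_prod[OF \<open>k < p\<close>] P_def[symmetric] A_def[symmetric]
      B_def[symmetric] w_def
    by (simp add: algebra_simps)
  with cong show ?thesis
    unfolding q_def by blast
qed

text \<open>Terms with \<open>k > h\<close> are divisible by \<open>p^2\<close> individually. Those
  with \<open>k \<le> h\<close> supply one \<open>p\<close> each, and the second comes only from
  their sum, through the vanishing alternating sum.\<close>

lemma sum_linear_domb_scaled_divisible: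
  assumes "prime p" "[p = 1] (mod 3)"
  shows "\<exists>z\<in>p_integral p. (\<Sum>n<p. (3 * of_nat n + 1) * domb_scaled n) = of_nat p ^ 2 * z"
proof -
  define X where "X k = domb_summand k * (fact (p + 2*k) / fact (p - k - 1)) / (3 * of_nat k + 2)" for k
  have mod3: "p mod 3 = 1"
    using assms(2) by (simp add: cong_def)
  have "p > 3"
    using mod3 prime_gt_1_nat[OF assms(1)] by presburger
  then have "odd p"
    using assms(1) prime_odd_nat by simp
  then obtain h where h: "p = 2 * h + 1"
    by (elim oddE)
  have "3 dvd p + 2"
    using mod3 by presburger
  then obtain a where a: "p + 2 = 3 * a"
    by (elim dvdE)
  \<comment> \<open>These bounds put \<open>a\<close> in the range where the alternating sum
    vanishes.\<close>
  have "1 \<le> a" "a \<le> h"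
    using h a \<open>p > 3\<close> by presburger+
  have "\<forall>k\<in>{..h}. \<exists>y. X k = of_nat p * y \<and> rat_cong_mod p y
    ((-1)^k * of_nat (h choose k) * of_nat ((h + k) choose k) / of_nat (k + a) * (1/3)) (int p)"
    unfolding X_def using domb_term_low[OF assms(1) h a] by auto
  then obtain y where y: "\<And>k. k \<in> {..h} \<Longrightarrow> X k = of_nat p * y k" "\<And>k. k \<in> {..h} \<Longrightarrow> rat_cong_mod p (y k)
    ((-1)^k * of_nat (h choose k) * of_nat ((h + k) choose k) / of_nat (k + a) * (1/3)) (int p)"
    by metis
  have "\<forall>k\<in>{h<..<p}. \<exists>z. z \<in> p_integral p \<and> X k = of_nat p ^ 2 * z"
  proof
    fix k assume "k \<in> {h<..<p}"
    then have "p \<le> 2 * k" "k < p"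
      using h by auto
    then show "\<exists>z. z \<in> p_integral p \<and> X k = of_nat p ^ 2 * z"
      unfolding X_def using domb_term_high[OF assms(1) \<open>p > 3\<close>] by blast
  qed
  then obtain z where z: "\<And>k. k \<in> {h<..<p} \<Longrightarrow> z k \<in> p_integral p" "\<And>k. k \<in> {h<..<p} \<Longrightarrow> X k = of_nat p ^ 2 * z k"
    by metis
  have "rat_cong_mod p (sum y {..h}) (\<Sum>k\<le>h.
      (-1)^k * of_nat (h choose k) * of_nat ((h + k) choose k) / of_nat (k + a) * (1/3)) (int p)"
    using y(2) by (rule rat_cong_mod_sum)
  also have "(\<Sum>k\<le>h. (-1)^k * of_nat (h choose k) * of_nat ((h + k) choose k) / of_nat (k + a) * (1/3)) = (0 :: rat)"
    unfolding sum_distrib_right[symmetric] using alternating_legendre_sum_eq_0[OF \<open>1 \<le> a\<close> \<open>a \<le> h\<close>] by simp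
  finally obtain t where t: "t \<in> p_integral p" "sum y {..h} = of_nat p * t"
    unfolding rat_cong_mod_iff by auto
  have "{..<p} = {..h} \<union> {h<..<p}"
    using h by auto
  then have "sum X {..<p} = sum X {..h} + sum X {h<..<p}"
    by (simp add: sum.union_disjoint disjoint_iff)
  also have "\<dots> = of_nat p * sum y {..h} + of_nat p ^ 2 * sum z {h<..<p}"
    using y(1) z(2) by (simp add: sum_distrib_left)
  also have "\<dots> = of_nat p ^ 2 * (t + sum z {h<..<p})"
    unfolding t by (simp add: power2_eq_square algebra_simps)
  finally have "(\<Sum>n<p. (3 * of_nat n + 1) * domb_scaled n)
      = of_nat p ^ 2 * ((3 * of_nat p - 1) * (t + sum z {h<..<p}))"
    unfolding sum_linear_domb_scaled X_def by simp
  moreover have "(3 * of_nat p - 1) * (t + sum z {h<..<p}) \<in> p_integral p"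
    using t(1) z(1) by (intro p_integral_mult p_integral_add p_integral_diff p_integral_sum) auto
  ultimately show ?thesis by blast
qed

theorem theorem4p2:
  fixes p :: nat
  assumes "prime p" and "[p = 1] (mod 3)"
  shows "rat_cong_mod p
           (\<Sum>n=2..p-1. (of_nat ((n+1)^2) / of_nat (n*(n-1))) * (of_nat (Domb n) / 16^n))
           (3/2) (int p^2)"
proof -
  obtain z where z: "z \<in> p_integral p" "(\<Sum>n<p. (3 * of_nat n + 1) * domb_scaled n) = of_nat p ^ 2 * z"
    using sum_linear_domb_scaled_divisible[OF assms] by blast
  have "p mod 3 = 1"
    using assms(2) by (simp add: cong_def)
  then have "p > 3"
    using prime_gt_1_nat[OF assms(1)] by presburger
  then obtain N where N: "p = N + 1" "N \<ge> 1"
    using that[of "p - 1"] by simp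
  define P where "P = (of_nat p :: rat)"
  have "\<not> p dvd 2"
    using \<open>p > 3\<close> by (auto dest: dvd_imp_le)
  then have z2: "z / 2 \<in> p_integral p"
    using p_integral_divide_of_nat[OF assms(1), of 2 z] z by simp
  have sc: "domb_scaled n \<in> p_integral p" for n
  proof -
    \<comment> \<open>The factor \<open>fact 0 ^ 5\<close> is \<open>1\<close>; it only fits
      \<open>16 ^ n\<close> to the shape of \<open>not_dvd_16_power_fact\<close>.\<close>
    have "\<not> p dvd 16 ^ n * fact 0 ^ 5"
      using assms(1) \<open>p > 3\<close> by (intro not_dvd_16_power_fact) auto
    then show ?thesis
      using p_integral_divide_of_nat[OF assms(1), of "16 ^ n" "of_nat (Domb n)"]
      by (simp add: domb_scaled_def)
  qed
  have "\<not> p dvd N"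
    using N by (auto dest: dvd_imp_le)
  then have mem: "z / 2 + domb_scaled N - 4 * P / of_nat N * domb_scaled p \<in> p_integral p"
    using z2 sc p_integral_divide_of_nat[OF assms(1)]
    by (intro p_integral_add p_integral_diff p_integral_mult) (auto simp: P_def)
  have "(\<Sum>n=2..p-1. (of_nat ((n+1)^2) / of_nat (n*(n-1))) * (of_nat (Domb n) / 16^n))
      = (\<Sum>n=2..N. of_nat ((n+1)^2) / of_nat (n*(n-1)) * domb_scaled n)"
    by (simp add: N domb_scaled_def)
  \<comment> \<open>At \<open>N = p - 1\<close> both boundary terms are multiples of
    \<open>P^2\<close>, and the denominator \<open>N\<close> is prime to \<open>p\<close>.\<close>
  also have "\<dots> = 3/2 + (\<Sum>n<p. (3 * of_nat n + 1) * domb_scaled n) / 2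
      + P^2 * domb_scaled N - 4 * P^3 / of_nat N * domb_scaled p"
    unfolding sum_domb_scaled_rational[OF N(2)] P_def N(1)
    by (simp add: lessThan_Suc_atMost add.commute del: sum.lessThan_Suc)
  also have "\<dots> - 3/2 = of_int (int p^2) * (z / 2 + domb_scaled N - 4 * P / of_nat N * domb_scaled p)"
    unfolding z(2) by (simp add: P_def algebra_simps power2_eq_square power3_eq_cube)
  finally show ?thesis
    unfolding rat_cong_mod_iff using mem by blast
qed

end
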